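(* For every integer $n>5$ there are at least seven prime numbers $p$ with $n<p<5n$. *)

theory Defs
  imports Complex_Main "HOL-Computational_Algebra.Primes"
begin

end

theory Submission
  imports Defs "HOL-Library.Discrete_Functions"
begin

text \<open>
  If \<open>D\<close> is a common multiple of \<open>1, \<dots>, N\<close>, then all the numbers
  \<open>k * (N choose k)\<close> divide \<open>D\<close>, because their reciprocals are the Beta integrals
  \<open>B(k, N - k + 1)\<close>; averaging over \<open>k\<close> gives \<open>2 ^ (N - 1) \<le> D\<close>. Choose \<open>D\<close> as the product of
  the maximal prime powers up to \<open>N = 5 * n\<close>, and let \<open>s\<close> be the integer part of \<open>sqrt N\<close>.
  The primes up to \<open>s\<close> contribute at most \<open>N ^ s\<close> to \<open>D\<close>, those in \<open>(s, n]\<close> at most \<open>4 ^ n\<close>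
  (the primorial bound), and those in \<open>(n, 5 * n)\<close>, if there are at most six, at most \<open>N ^ 6\<close>.
  This contradicts the lower bound as soon as \<open>s \<ge> 31\<close>, and five explicit lists of primes cover
  the remaining \<open>n\<close>.
\<close>

section \<open>Common multiples of an initial segment\<close>

text \<open>The induction is the recurrence \<open>B(k, d + 2) = B(k, d + 1) - B(k + 1, d + 1)\<close>,
  multiplied by \<open>D\<close>.\<close>

lemma mult_binomial_dvd_common_multiple:
  fixes D k d :: nat
  assumes "k \<ge> 1" "\<And>j. j \<in> {1..k + d} \<Longrightarrow> j dvd D"
  shows "k * (k + d choose k) dvd D"
  using assms
proof (induction d arbitrary: k)
  case 0
  then show ?case by simp
next
  case (Suc d)
  let ?n = "k + Suc d"
  have "k * (k + d choose k) dvd D"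
    using Suc.prems by (intro Suc.IH) auto
  then obtain a where a: "D = k * (k + d choose k) * a" by (elim dvdE)
  have "Suc k * (Suc k + d choose Suc k) dvd D"
    using Suc.prems by (intro Suc.IH) auto
  then obtain b where b: "D = Suc k * (Suc k + d choose Suc k) * b" by (elim dvdE)
  have "Suc k * (Suc k + d choose Suc k) = ?n * (k + d choose k)"
    using Suc_times_binomial_eq[of "k + d" k] by (simp add: mult.commute)
  with b have b': "D = ?n * (k + d choose k) * b" by simp
  have "Suc d * (?n choose k) = ?n * (k + d choose k)"
    using binomial_absorb_comp[of ?n k] by simp
  then have c: "int (Suc d) * int (?n choose k) = int ?n * int (k + d choose k)"
    by (metis of_nat_mult)
  \<comment> \<open>\<open>a\<close> and \<open>b\<close> are \<open>D\<close> times the two Beta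
    values, so \<open>a - b\<close> is the sought cofactor. It is taken in \<open>int\<close>
    because natural subtraction truncates.\<close>
  have "int (Suc d) * (int k * int (?n choose k) * (int a - int b))
      = int k * (int ?n * int (k + d choose k)) * (int a - int b)"
    unfolding c[symmetric] by (simp only: mult_ac)
  also have "\<dots> = int ?n * (int k * int (k + d choose k) * int a)
      - int k * (int ?n * int (k + d choose k) * int b)"
    by (simp only: right_diff_distrib left_diff_distrib mult_ac)
  also have "\<dots> = int ?n * int D - int k * int D"
    by (simp only: a[symmetric] b'[symmetric] of_nat_mult[symmetric])
  also have "\<dots> = int (Suc d) * int D"
    by (simp add: algebra_simps)
  finally have "int (k * (?n choose k)) * (int a - int b) = int D"
    by simp
  then have "int (k * (?n choose k)) dvd int D"
    by (metis dvd_triv_left)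
  then show ?case
    using of_nat_dvd_iff by blast
qed

lemma common_multiple_ge_power2:
  fixes D N :: nat
  assumes "N \<ge> 1" "D > 0" "\<And>j. j \<in> {1..N} \<Longrightarrow> j dvd D"
  shows "2 ^ (N - 1) \<le> D"
proof -
  have le: "k * (N choose k) \<le> D" if "k \<in> {1..N}" for k
    using that mult_binomial_dvd_common_multiple[of k "N - k" D] assms
    by (intro dvd_imp_le) auto
  have "N * 2 ^ (N - 1) = (\<Sum>k\<le>N. k * (N choose k))"
    by (simp add: choose_linear_sum)
  also have "\<dots> = (\<Sum>k\<in>{1..N}. k * (N choose k))"
    by (rule sum.mono_neutral_right) auto
  also have "\<dots> \<le> N * D"
    using sum_bounded_above[of "{1..N}" "\<lambda>k. k * (N choose k)" D] le by simp
  finally show ?thesis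
    using assms(1) by simp
qed

section \<open>Products of primes\<close>

lemma prod_primes_dvd:
  fixes A :: "nat set" and m :: nat
  assumes "finite A" "\<And>p. p \<in> A \<Longrightarrow> prime p" "\<And>p. p \<in> A \<Longrightarrow> p dvd m"
  shows "\<Prod>A dvd m"
  using assms
proof (induction A rule: finite_induct)
  case empty
  then show ?case by simp
next
  case (insert p A)
  have "coprime p (\<Prod>A)"
    using insert.hyps insert.prems by (intro prod_coprime_right primes_coprime) auto
  with insert show ?case
    by (auto intro: divides_mult)
qed

text \<open>The two middle entries of row \<open>2 * m + 1\<close> are equal, and the whole row sums
  to \<open>2 * 4 ^ m\<close>.\<close>

lemma central_binomial_odd_le:
  "(2 * m + 1 choose m) \<le> 4 ^ m"
proof -
  have "(2 * m + 1 choose m) + (2 * m + 1 choose Suc m)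
      = (\<Sum>k\<in>{m, Suc m}. 2 * m + 1 choose k)" by simp
  also have "\<dots> \<le> (\<Sum>k\<le>2 * m + 1. 2 * m + 1 choose k)"
    by (rule sum_mono2) auto
  also have "\<dots> = 2 * 4 ^ m"
    by (simp only: choose_row_sum) (simp add: power_mult)
  finally show ?thesis
    using binomial_symmetric[of m "2 * m + 1"] by simp
qed

text \<open>Erdos' induction: an even \<open>n > 2\<close> adds no prime; for
  \<open>n = 2 * m + 1\<close> the primes above \<open>m + 1\<close> divide
  \<open>2 * m + 1 choose m\<close>, and the others fall under the bound for
  \<open>m + 1\<close>.\<close>

lemma primorial_le: "\<Prod>{p :: nat. prime p \<and> p \<le> n} \<le> 4 ^ n"
proof (induction n rule: less_induct)
  case (less n)
  consider "n < 2" | "n = 2" | "n > 2" "even n" | "n > 2" "odd n" by linarith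
  then show ?case
  proof cases
    case 1
    then have "{p :: nat. prime p \<and> p \<le> n} = {}"
      by (auto dest: prime_ge_2_nat)
    then show ?thesis by (metis prod.empty one_le_power one_le_numeral)
  next
    case 2
    then have "{p :: nat. prime p \<and> p \<le> n} = {2}"
      by (auto dest: prime_ge_2_nat)
    then show ?thesis using 2 by simp
  next
    case 3
    then have "\<not> prime n" using prime_odd_nat by blast
    then have "{p :: nat. prime p \<and> p \<le> n} = {p. prime p \<and> p \<le> n - 1}"
      by (auto simp: le_less)
    moreover have "\<Prod>{p :: nat. prime p \<and> p \<le> n - 1} \<le> 4 ^ (n - 1)"
      using 3 by (intro less) auto
    moreover have "(4 :: nat) ^ (n - 1) \<le> 4 ^ n" by (intro power_increasing) auto
    ultimately show ?thesis by (metis order_trans)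
  next
    case 4
    then obtain m where m: "n = 2 * m + 1" "m \<ge> 1" by (auto elim: oddE)
    let ?A = "{p :: nat. prime p \<and> p \<le> m + 1}"
    let ?B = "{p :: nat. prime p \<and> m + 1 < p \<and> p \<le> n}"
    have "p dvd (2 * m + 1 choose m)" if "p \<in> ?B" for p
    proof -
      from that have p: "prime p" "m + 1 < p" "p \<le> 2 * m + 1" using m by auto
      have "fact m * fact (m + 1) * (2 * m + 1 choose m) = (fact (2 * m + 1) :: nat)"
        using binomial_fact_lemma[of m "2 * m + 1"] by simp
      moreover have "p dvd fact (2 * m + 1)" "\<not> p dvd fact m" "\<not> p dvd fact (m + 1)"
        using p by (simp_all add: prime_dvd_fact_iff del: fact_Suc)
      ultimately show ?thesis
        using p(1) by (metis prime_dvd_mult_iff)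
    qed
    then have "\<Prod>?B \<le> (2 * m + 1 choose m)"
      by (intro dvd_imp_le prod_primes_dvd) auto
    also have "\<dots> \<le> 4 ^ m" by (rule central_binomial_odd_le)
    finally have B: "\<Prod>?B \<le> 4 ^ m" .
    have A: "\<Prod>?A \<le> 4 ^ (m + 1)" using m by (intro less) auto
    have "{p :: nat. prime p \<and> p \<le> n} = ?A \<union> ?B" using m by auto
    then have "\<Prod>{p :: nat. prime p \<and> p \<le> n} = \<Prod>?A * \<Prod>?B"
      by (simp only:) (rule prod.union_disjoint, auto)
    also have "\<dots> \<le> 4 ^ (m + 1) * 4 ^ m" by (intro mult_mono A B) auto
    also have "\<dots> = 4 ^ n" by (simp add: m flip: power_add)
    finally show ?thesis .
  qed
qed

section \<open>The product of the maximal prime powers up to a bound\<close>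

text \<open>Over the primes up to \<open>N\<close> these factors multiply to the least common
  multiple of \<open>1, ..., N\<close>.\<close>

definition max_prime_power :: "nat \<Rightarrow> nat \<Rightarrow> nat" where
  "max_prime_power N p = p ^ (GREATEST e. p ^ e \<le> N)"

lemma
  assumes "prime p" "N \<ge> 1"
  shows max_prime_power_le: "max_prime_power N p \<le> N"
    and power_dvd_max_prime_power: "p ^ e \<le> N \<Longrightarrow> p ^ e dvd max_prime_power N p"
proof -
  \<comment> \<open>\<open>GREATEST\<close> is meaningful only for a nonempty bounded set of
    exponents.\<close>
  have bound: "e \<le> N" if "p ^ e \<le> N" for e
  proof -
    have "e < 2 ^ e" by (rule less_exp)
    also have "\<dots> \<le> p ^ e" using prime_ge_2_nat[OF assms(1)] by (rule power_mono) simp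
    finally show ?thesis using that by simp
  qed
  have "p ^ 0 \<le> N" using assms by simp
  from GreatestI_nat[of "\<lambda>e. p ^ e \<le> N", OF this bound]
  show "max_prime_power N p \<le> N" by (simp add: max_prime_power_def)
  show "p ^ e dvd max_prime_power N p" if "p ^ e \<le> N"
    unfolding max_prime_power_def
    using Greatest_le_nat[of "\<lambda>e. p ^ e \<le> N", OF that bound]
    by (rule le_imp_power_dvd)
qed

lemma max_prime_power_le_prime:
  assumes "prime p" "N \<ge> 1" "N < p ^ 2"
  shows "max_prime_power N p \<le> p"
proof -
  define e where "e = (GREATEST e. p ^ e \<le> N)"
  have "p ^ e < p ^ 2"
    using max_prime_power_le[OF assms(1,2)] assms(3) by (simp add: max_prime_power_def e_def)
  then have "e < 2" using prime_gt_1_nat[OF assms(1)] by simp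
  then have "p ^ e \<le> p ^ 1" using prime_gt_0_nat[OF assms(1)] by (intro power_increasing) auto
  then show ?thesis by (simp add: max_prime_power_def e_def)
qed

text \<open>Each prime power in the factorisation of \<open>j\<close> is at most \<open>N\<close>,
  so it divides the factor of its prime.\<close>

lemma dvd_prod_max_prime_power:
  assumes "j \<in> {1..N}"
  shows "j dvd (\<Prod>p | prime p \<and> p \<le> N. max_prime_power N p)"
proof -
  have "j = (\<Prod>p\<in>prime_factors j. p ^ multiplicity p j)"
    using assms by (simp add: prime_factorization_nat)
  also have "\<dots> dvd (\<Prod>p | prime p \<and> p \<le> N. max_prime_power N p)"
  proof (rule prod_dvd_prod_subset2)
    show "prime_factors j \<subseteq> {p. prime p \<and> p \<le> N}"
      using assms by (auto simp: prime_factors_dvd dest: dvd_imp_le)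
    show "p ^ multiplicity p j dvd max_prime_power N p" if "p \<in> prime_factors j" for p
    proof (rule power_dvd_max_prime_power)
      have "p ^ multiplicity p j \<le> j"
        using assms by (intro dvd_imp_le multiplicity_dvd) auto
      then show "p ^ multiplicity p j \<le> N" using assms by auto
    qed (use that assms in auto)
  qed simp
  finally show ?thesis .
qed

lemma power2_le_prod_max_prime_power:
  assumes "N \<ge> 1"
  shows "2 ^ (N - 1) \<le> (\<Prod>p | prime p \<and> p \<le> N. max_prime_power N p)"
  using assms dvd_prod_max_prime_power
  by (intro common_multiple_ge_power2)
     (auto intro!: prod_pos simp: max_prime_power_def prime_gt_0_nat)

lemma prod_max_prime_power_le:
  fixes N n s :: nat
  assumes "n \<le> N" "N \<ge> 1" "N < (s + 1) ^ 2"
  shows "(\<Prod>p | prime p \<and> p \<le> N. max_prime_power N p)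
      \<le> N ^ s * 4 ^ n * N ^ card {p. prime p \<and> n < p \<and> p \<le> N}"
proof -
  let ?f = "max_prime_power N"
  let ?P = "{p :: nat. prime p \<and> p \<le> N}"
  \<comment> \<open>The condition \<open>p \<le> n\<close> in \<open>?A\<close> keeps the three sets
    disjoint even if \<open>s > n\<close>.\<close>
  let ?A = "{p \<in> ?P. p \<le> s \<and> p \<le> n}" and ?B = "{p \<in> ?P. s < p \<and> p \<le> n}"
    and ?C = "{p. prime p \<and> n < p \<and> p \<le> N}"
  have bound: "prod ?f S \<le> N ^ card S" if "S \<subseteq> ?P" for S
    using that max_prime_power_le[OF _ assms(2)] by (intro prod_le_power assms(2)) auto
  have "card ?A \<le> card {1..s}"
    by (rule card_mono) (auto dest: prime_ge_1_nat)
  then have A: "prod ?f ?A \<le> N ^ s"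
    using power_increasing[of "card ?A" s N] assms(2)
    by (intro order_trans[OF bound]) auto
  have "prod ?f ?B \<le> \<Prod>?B"
  proof (rule prod_mono)
    fix p assume p: "p \<in> ?B"
    then have "(s + 1) ^ 2 \<le> p ^ 2" by (intro power_mono) auto
    then have "N < p ^ 2" using assms(3) by linarith
    with p assms(2) show "0 \<le> ?f p \<and> ?f p \<le> p"
      by (auto intro: max_prime_power_le_prime)
  qed
  also have "\<dots> \<le> \<Prod>{p. prime p \<and> p \<le> n}"
    by (rule dvd_imp_le[OF prod_dvd_prod_subset]) (auto intro!: prod_pos prime_gt_0_nat)
  also have "\<dots> \<le> 4 ^ n" by (rule primorial_le)
  finally have B: "prod ?f ?B \<le> 4 ^ n" .
  have C: "prod ?f ?C \<le> N ^ card ?C" by (rule bound) auto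
  have "?P = (?A \<union> ?B) \<union> ?C" using assms(1) by auto
  then have "prod ?f ?P = prod ?f ((?A \<union> ?B) \<union> ?C)" by (rule arg_cong)
  also have "\<dots> = prod ?f (?A \<union> ?B) * prod ?f ?C"
    by (rule prod.union_disjoint) auto
  also have "prod ?f (?A \<union> ?B) = prod ?f ?A * prod ?f ?B"
    by (rule prod.union_disjoint) auto
  also have "prod ?f ?A * prod ?f ?B * prod ?f ?C \<le> N ^ s * 4 ^ n * N ^ card ?C"
    by (intro mult_mono A B C) auto
  finally show ?thesis .
qed

section \<open>Primes between \<open>n\<close> and \<open>5 * n\<close>\<close>

text \<open>The tangent to the binary logarithm at \<open>32\<close>, with its slope rounded up to \<open>1 / 20\<close>.\<close>

lemma power20_le_power2:
  fixes s :: nat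
  assumes "s \<ge> 31"
  shows "(s + 1) ^ 20 \<le> 2 ^ (s + 69)"
  using assms
proof (induction s rule: dec_induct)
  case base
  show ?case by simp
next
  case (step s)
  \<comment> \<open>For \<open>s \<ge> 31\<close> the base grows by a factor of at most
    \<open>33 / 32\<close>, whose 20th power is below \<open>2\<close>.\<close>
  have "(32 * (s + 2)) ^ 20 \<le> (33 * (s + 1)) ^ 20"
    using step.hyps by (intro power_mono) auto
  then have "32 ^ 20 * (s + 2) ^ 20 \<le> 33 ^ 20 * (s + 1) ^ 20"
    by (simp only: power_mult_distrib)
  also have "\<dots> \<le> (2 * 32 ^ 20) * (s + 1) ^ 20"
    by (intro mult_right_mono) auto
  also have "\<dots> \<le> (2 * 32 ^ 20) * 2 ^ (s + 69)"
    by (intro mult_left_mono step.IH) auto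
  finally have "(s + 2) ^ 20 \<le> 2 * 2 ^ (s + 69)"
    by simp
  also have "\<dots> = 2 ^ (Suc s + 69)"
    by (simp only: add_Suc power_Suc)
  finally show ?case
    by (simp only: Suc_eq_plus1 add.assoc one_add_one)
qed

text \<open>\<open>193\<close> is the least \<open>n\<close> with \<open>5 * n \<ge> 31 ^ 2\<close>,
  which yields \<open>s \<ge> 31\<close>.\<close>

lemma card_primes_large:
  fixes n :: nat
  assumes "n \<ge> 193"
  shows "card {p. prime p \<and> n < p \<and> p \<le> 5 * n} \<ge> 7"
proof (rule ccontr)
  let ?c = "card {p. prime p \<and> n < p \<and> p \<le> 5 * n}"
  assume "\<not> ?c \<ge> 7"
  then have c: "?c \<le> 6" by simp
  define s where "s = floor_sqrt (5 * n)"
  have s: "s ^ 2 \<le> 5 * n" "5 * n < (s + 1) ^ 2"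
    unfolding s_def using Suc_floor_sqrt_power2_gt[of "5 * n"] by simp_all
  have "31 ^ 2 < (s + 1) ^ 2" using s(2) assms by simp
  then have "31 < s + 1" by (rule power_less_imp_less_base) simp
  then have s31: "s \<ge> 31" by simp
  \<comment> \<open>The part \<open>2 ^ (2 * n)\<close> is split off to cancel the primorial bound
    \<open>4 ^ n\<close>.\<close>
  have "5 * n - 1 = 2 * n + (3 * n - 1)" using assms by simp
  then have "2 ^ (2 * n) * 2 ^ (3 * n - 1) = (2 :: nat) ^ (5 * n - 1)"
    by (simp only: power_add)
  also have "\<dots> \<le> (\<Prod>p | prime p \<and> p \<le> 5 * n. max_prime_power (5 * n) p)"
    using assms by (intro power2_le_prod_max_prime_power) simp
  also have "\<dots> \<le> (5 * n) ^ s * 4 ^ n * (5 * n) ^ ?c"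
    using assms s(2) by (intro prod_max_prime_power_le) auto
  also have "\<dots> \<le> (5 * n) ^ s * 4 ^ n * (5 * n) ^ 6"
    using c assms by (intro mult_left_mono power_increasing) auto
  also have "\<dots> = 2 ^ (2 * n) * (5 * n) ^ (s + 6)"
    by (simp add: power_mult power_add)
  finally have "2 ^ (3 * n - 1) \<le> (5 * n) ^ (s + 6)" by simp
  also have "\<dots> \<le> ((s + 1) ^ 2) ^ (s + 6)" using s(2) by (intro power_mono) auto
  \<comment> \<open>The 10th power turns the base \<open>(s + 1) ^ 2\<close> into
    \<open>(s + 1) ^ 20\<close>, as in \<open>power20_le_power2\<close>.\<close>
  finally have "((2 :: nat) ^ (3 * n - 1)) ^ 10 \<le> (((s + 1) ^ 2) ^ (s + 6)) ^ 10"
    by (intro power_mono) auto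
  also have "\<dots> = ((s + 1) ^ 20) ^ (s + 6)"
    by (simp only: power_mult[symmetric]) (simp add: algebra_simps)
  also have "\<dots> \<le> (2 ^ (s + 69)) ^ (s + 6)"
    by (intro power_mono power20_le_power2 s31) auto
  finally have "(2 :: nat) ^ ((3 * n - 1) * 10) \<le> 2 ^ ((s + 69) * (s + 6))"
    by (simp only: power_mult)
  then have "(3 * n - 1) * 10 \<le> (s + 69) * (s + 6)"
    by (rule power_le_imp_le_exp[rotated]) simp
  then have "30 * n \<le> s * s + 75 * s + 424"
    using assms by (simp add: algebra_simps)
  \<comment> \<open>Eliminating \<open>n\<close> leaves \<open>5 * s * s \<le> 75 * s + 424\<close>,
    hence \<open>80 * s \<le> 424\<close>.\<close>
  moreover have "6 * (s * s) \<le> 30 * n" using s(1) by (simp add: power2_eq_square)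
  moreover have "31 * s \<le> s * s" using s31 by simp
  ultimately show False using s31 by linarith
qed

section \<open>Explicit prime lists and the final case distinction\<close>

lemma finite_primes_between: "finite {p :: int. prime p \<and> a < p \<and> p < b}"
  by (rule finite_subset[of _ "{a..b}"]) auto

lemma card_primes_ge_7I:
  fixes n :: int
  assumes "list_all prime ps" "list_all (\<lambda>p. n < p \<and> p < 5 * n) ps"
    and "distinct ps" "length ps = 7"
  shows "card {p :: int. prime p \<and> n < p \<and> p < 5 * n} \<ge> 7"
proof -
  have "card (set ps) \<le> card {p :: int. prime p \<and> n < p \<and> p < 5 * n}"
    using assms(1,2) by (intro card_mono finite_primes_between) (auto simp: list_all_iff)
  then show ?thesis using assms(3,4) by (simp add: distinct_card)
qed

text \<open>Two factors of size at least \<open>k\<close> would have a product of at least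
  \<open>k * k\<close>. Below, \<open>k = 23\<close> suffices, as the largest listed prime is
  \<open>523 < 23 ^ 2\<close>.\<close>

lemma prime_nat_trial_division:
  fixes p k :: nat
  assumes "1 < p" "p < k * k" "\<forall>d\<in>set [2..<k]. \<not> d dvd p"
  shows "prime p"
proof (rule ccontr)
  assume "\<not> prime p"
  then obtain a where "a dvd p" "a \<noteq> 1" "a \<noteq> p"
    using assms(1) by (auto simp: prime_nat_iff)
  then obtain b where "p = a * b" by (elim dvdE)
  with \<open>a \<noteq> 1\<close> \<open>a \<noteq> p\<close> assms(1) have ab: "p = a * b" "1 < a" "1 < b"
    by (auto simp: nat_neq_iff)
  then have "a < k \<or> b < k"
    using assms(2) mult_le_mono[of k a k b] by linarith
  moreover have "\<not> a < k" "\<not> b < k"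
    using ab assms(3) by (auto dest: bspec[of _ _ a] bspec[of _ _ b])
  ultimately show False by blast
qed

text \<open>The default simplification rule for numerals tries all divisors up to half of the number.\<close>

lemmas prime_trial_division_23 = prime_nat_trial_division[of "numeral p" 23 for p]

theorem theorem3p1p2:
  fixes n :: int
  assumes "n > 5"
  shows "card {p :: int. prime p \<and> n < p \<and> p < 5 * n} \<ge> 7"
proof -
  \<comment> \<open>A list from \<open>q\<close> to \<open>r\<close> serves all \<open>n < q\<close>
    with \<open>r < 5 * n\<close>.\<close>
  consider "n = 6" | "7 \<le> n" "n \<le> 10" | "11 \<le> n" "n \<le> 28" | "29 \<le> n" "n \<le> 106"
    | "107 \<le> n" "n \<le> 192" | "193 \<le> n"
    using assms by linarith
  then show ?thesis
  proof cases
    case 1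
    then show ?thesis by (intro card_primes_ge_7I[of "[7, 11, 13, 17, 19, 23, 29]"]) auto
  next
    case 2
    then show ?thesis by (intro card_primes_ge_7I[of "[11, 13, 17, 19, 23, 29, 31]"]) auto
  next
    case 3
    then show ?thesis by (intro card_primes_ge_7I[of "[29, 31, 37, 41, 43, 47, 53]"]) auto
  next
    case 4
    then show ?thesis
      by (intro card_primes_ge_7I[of "[107, 109, 113, 127, 131, 137, 139]"])
        (simp_all add: prime_trial_division_23 del: prime_nat_numeral_eq)
  next
    case 5
    then show ?thesis
      by (intro card_primes_ge_7I[of "[487, 491, 499, 503, 509, 521, 523]"])
        (simp_all add: prime_trial_division_23 del: prime_nat_numeral_eq)
  next
    case 6
    define m where "m = nat n"
    have m: "n = int m" "m \<ge> 193" using 6 by (auto simp: m_def)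
    \<comment> \<open>\<open>card_primes_large\<close> allows \<open>p = 5 * m\<close>;
      compositeness makes that bound strict.\<close>
    have "\<not> prime (5 * m)"
    proof
      assume "prime (5 * m)"
      then show False using prime_product[of 5 m] m(2) by simp
    qed
    then have less: "p < 5 * m" if "prime p" "p \<le> 5 * m" for p
      using that le_neq_implies_less by blast
    have "card (int ` {p. prime p \<and> m < p \<and> p \<le> 5 * m})
        \<le> card {p. prime p \<and> n < p \<and> p < 5 * n}"
    proof (intro card_mono finite_primes_between image_subsetI)
      fix p assume "p \<in> {p. prime p \<and> m < p \<and> p \<le> 5 * m}"
      with less[of p] m(1) show "int p \<in> {p. prime p \<and> n < p \<and> p < 5 * n}" by simp
    qed
    with card_primes_large[OF m(2)] show ?thesis
      by (simp add: card_image)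
  qed
qed

end
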